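(* Let $N\ge3$, $d>0$, $p\in\mathbb R$, $V\in\mathbb R^N$ (indexed by $\mathbb Z/N\mathbb Z$), and let $\Lambda_p(V)$ be the principal eigenvalue of the operator on $\mathbb R^{\mathbb Z/N\mathbb Z}$ $$(\mathcal L_{p,V}u)_j=d\,(e^{-p}u_{j+1}+e^{p}u_{j-1}-2u_j)+V_ju_j,\qquad j\in\mathbb Z/N\mathbb Z.$$ Then $$\Lambda_p(V)=\max_{a\in\mathcal P_N}\left\{2d\,\mathcal T_{Np}(a)-2d+\sum_jV_ja_j^2\right\}.$$
   Context: Indices are taken modulo $N$. $\mathcal P_N=\{a\in(0,\infty)^N:\sum_ja_j^2=1\}$. For $\sigma\in\mathbb R$ and $a\in\mathcal P_N$, $$\mathcal T_\sigma(a):=\min_{\substack{\theta\in\mathbb R^N\\ \sum_j\theta_j=\sigma}}\ \sum_{j=0}^{N-1}a_ja_{j+1}\cosh\theta_j .$$ The matrix of $\mathcal L_{p,V}$ is irreducible and Metzler (nonnegative off-diagonal entries); its principal eigenvalue is its spectral bound (largest real part of an eigenvalue), a real, algebraically simple eigenvalue with a positive eigenvector. *)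

theory Defs
  imports "Jordan_Normal_Form.Spectral_Radius"
begin

text \<open>
  Vectors in \<open>\<real>\<^sup>N\<close> are elements of \<^term>\<open>carrier_vec N\<close>, with indices \<open>0, \<dots>, N - 1\<close> read modulo
  \<open>N\<close>; the predecessor of \<open>j\<close> is written \<open>(j + N - 1) mod N\<close> because subtraction on
  \<^typ>\<open>nat\<close> truncates.
\<close>

definition advection_op :: "nat \<Rightarrow> real \<Rightarrow> real \<Rightarrow> real vec \<Rightarrow> real vec \<Rightarrow> real vec" where
  "advection_op N d p V u =
     vec N (\<lambda>j. d * (exp (- p) * u $ ((j + 1) mod N) + exp p * u $ ((j + N - 1) mod N) - 2 * u $ j)
                + V $ j * u $ j)"

definition matrix_of_op :: "nat \<Rightarrow> (real vec \<Rightarrow> real vec) \<Rightarrow> real mat" where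
  "matrix_of_op N T = mat N N (\<lambda>(i, j). T (unit_vec N j) $ i)"

definition spectral_bound :: "real mat \<Rightarrow> real" where
  "spectral_bound A = Max (Re ` spectrum (map_mat complex_of_real A))"

definition principal_eigenvalue :: "nat \<Rightarrow> real \<Rightarrow> real \<Rightarrow> real vec \<Rightarrow> real" where
  "principal_eigenvalue N d p V = spectral_bound (matrix_of_op N (advection_op N d p V))"

definition pos_sphere :: "nat \<Rightarrow> real vec set" where
  "pos_sphere N = {a \<in> carrier_vec N. (\<forall>j<N. 0 < a $ j) \<and> (\<Sum>j<N. (a $ j)\<^sup>2) = 1}"

text \<open>
  The minimum is rendered with \<^const>\<open>Least\<close>, which is meaningful only if the minimum is attained;
  for positive weights it is, see \<open>cyclic_cost_attained\<close> and \<open>cyclic_cost_le\<close> below.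
\<close>

definition cyclic_cost :: "nat \<Rightarrow> real \<Rightarrow> real vec \<Rightarrow> real" where
  "cyclic_cost N \<sigma> a =
     (LEAST y. \<exists>\<theta> \<in> carrier_vec N. (\<Sum>j<N. \<theta> $ j) = \<sigma> \<and>
        y = (\<Sum>j<N. a $ j * a $ ((j + 1) mod N) * cosh (\<theta> $ j)))"

lemma matrix_of_advection_op:
  assumes u: "u \<in> carrier_vec N"
  shows "matrix_of_op N (advection_op N d p V) *\<^sub>v u = advection_op N d p V u"
proof (rule eq_vecI)
  fix i assume "i < dim_vec (advection_op N d p V u)"
  then have i: "i < N" by (simp add: advection_op_def)
  have lt: "(i + 1) mod N < N" "(i + N - 1) mod N < N" using i by auto
  have pick: "(\<Sum>j<N. unit_vec N j $ k * u $ j) = u $ k" if k: "k < N" for k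
  proof -
    have "(\<Sum>j<N. unit_vec N j $ k * u $ j) = (\<Sum>j<N. if k = j then u $ j else 0)"
      by (rule sum.cong) (use k in \<open>auto simp: unit_vec_def\<close>)
    also have "\<dots> = u $ k" using k by simp
    finally show ?thesis .
  qed
  have "(matrix_of_op N (advection_op N d p V) *\<^sub>v u) $ i
      = (\<Sum>j<N. advection_op N d p V (unit_vec N j) $ i * u $ j)"
    using u i by (auto simp: matrix_of_op_def scalar_prod_def lessThan_atLeast0 intro!: sum.cong)
  also have "\<dots> = (\<Sum>j<N. d * exp (- p) * (unit_vec N j $ ((i + 1) mod N) * u $ j)
      + d * exp p * (unit_vec N j $ ((i + N - 1) mod N) * u $ j)
      + (V $ i - 2 * d) * (unit_vec N j $ i * u $ j))"
    by (rule sum.cong) (use i in \<open>auto simp: advection_op_def algebra_simps\<close>)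
  also have "\<dots> = d * exp (- p) * u $ ((i + 1) mod N) + d * exp p * u $ ((i + N - 1) mod N)
      + (V $ i - 2 * d) * u $ i"
    unfolding sum.distrib sum_distrib_left[symmetric] pick[OF lt(1)] pick[OF lt(2)] pick[OF i] ..
  also have "\<dots> = advection_op N d p V u $ i"
    using i by (simp add: advection_op_def algebra_simps)
  finally show "(matrix_of_op N (advection_op N d p V) *\<^sub>v u) $ i = advection_op N d p V u $ i" .
qed (simp add: matrix_of_op_def advection_op_def)

lemma spectral_bound_props:
  assumes A: "A \<in> carrier_mat n n" and n: "n > 0"
  shows "\<exists>k. eigenvalue (map_mat complex_of_real A) k \<and> Re k = spectral_bound A"
    and "eigenvalue (map_mat complex_of_real A) k \<Longrightarrow> Re k \<le> spectral_bound A"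
proof -
  let ?S = "spectrum (map_mat complex_of_real A)"
  have A': "map_mat complex_of_real A \<in> carrier_mat n n" using A by simp
  have fin: "finite ?S" and ne: "?S \<noteq> {}"
    using card_finite_spectrum(1)[OF A'] spectrum_non_empty[OF A' n] by auto
  have "Max (Re ` ?S) \<in> Re ` ?S" using fin ne by (intro Max_in) auto
  then show "\<exists>k. eigenvalue (map_mat complex_of_real A) k \<and> Re k = spectral_bound A"
    unfolding spectral_bound_def spectrum_def by force
  show "eigenvalue (map_mat complex_of_real A) k \<Longrightarrow> Re k \<le> spectral_bound A"
    unfolding spectral_bound_def using fin by (intro Max_ge) (auto simp: spectrum_def)
qed

lemma cosh_tangent:
  fixes x y :: real
  shows "cosh y + sinh y * (x - y) \<le> cosh x"
proof -
  have e: "exp y * (1 + (x - y)) \<le> exp x" for x y :: real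
    using exp_ge_add_one_self[of "x - y"]
    by (simp add: exp_diff pos_le_divide_eq mult.commute)
  show ?thesis
    using e[of y x] e[of "- y" "- x"] by (simp add: cosh_def sinh_def algebra_simps field_simps)
qed

lemma weighted_cosh_min_exists:
  fixes w :: "nat \<Rightarrow> real"
  assumes N: "0 < N" and w: "\<And>j. j < N \<Longrightarrow> 0 < w j"
  shows "\<exists>\<theta>. (\<Sum>j<N. \<theta> j) = \<sigma> \<and>
    (\<forall>\<phi>. (\<Sum>j<N. \<phi> j) = \<sigma> \<longrightarrow> (\<Sum>j<N. w j * cosh (\<theta> j)) \<le> (\<Sum>j<N. w j * cosh (\<phi> j)))"
proof -
  define g where "g m = (\<Sum>j<N. arsinh (m / w j))" for m
  let ?m = "w 0 * sinh \<sigma>"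
  have w0: "0 < w 0" using N w by auto
  have split: "g m = arsinh (m / w 0) + (\<Sum>j\<in>{..<N} - {0}. arsinh (m / w j))" for m
    unfolding g_def using N by (subst sum.remove[of _ 0]) auto
  have cont: "continuous_on S g" for S
    unfolding g_def by (intro continuous_intros) (use w in force)+
  have arsinh_ge: "0 \<le> arsinh x" if "0 \<le> x" for x :: real
    using that by (cases "x = 0") (auto intro: less_imp_le)
  have arsinh_le: "arsinh x \<le> 0" if "x \<le> 0" for x :: real
    using arsinh_ge[of "- x"] that by simp
  have g0: "g 0 = 0" by (simp add: g_def)
  have at: "arsinh (?m / w 0) = \<sigma>" using w0 by (simp add: arsinh_sinh_real)
  have "\<exists>m. g m = \<sigma>"
  proof (cases "0 \<le> \<sigma>")
    case True
    then have m: "0 \<le> ?m" using w0 by simp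
    have "\<sigma> \<le> g ?m"
      unfolding split at using m w by (auto intro!: sum_nonneg arsinh_ge divide_nonneg_pos)
    then show ?thesis using IVT'[of g 0 \<sigma> ?m] g0 True m cont by auto
  next
    case False
    then have m: "?m \<le> 0" using w0 by (simp add: mult_le_0_iff)
    have "g ?m \<le> \<sigma>"
      unfolding split at using m w by (auto intro!: sum_nonpos arsinh_le divide_nonpos_pos)
    then show ?thesis using IVT'[of g ?m \<sigma> 0] g0 False m cont by auto
  qed
  then obtain m where m: "g m = \<sigma>" ..
  define \<theta> where "\<theta> j = arsinh (m / w j)" for j
  have s: "(\<Sum>j<N. \<theta> j) = \<sigma>" using m by (simp add: \<theta>_def g_def)
  moreover have "(\<Sum>j<N. w j * cosh (\<theta> j)) \<le> (\<Sum>j<N. w j * cosh (\<phi> j))"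
    if \<phi>: "(\<Sum>j<N. \<phi> j) = \<sigma>" for \<phi>
  proof -
    have *: "w j * cosh (\<theta> j) + m * (\<phi> j - \<theta> j) \<le> w j * cosh (\<phi> j)" if j: "j < N" for j
    proof -
      have "w j * (cosh (\<theta> j) + sinh (\<theta> j) * (\<phi> j - \<theta> j)) \<le> w j * cosh (\<phi> j)"
        using cosh_tangent w[OF j] by (intro mult_left_mono) auto
      moreover have "w j * sinh (\<theta> j) = m" using w[OF j] by (simp add: \<theta>_def)
      ultimately show ?thesis by (simp add: distrib_left flip: mult.assoc)
    qed
    have "(\<Sum>j<N. w j * cosh (\<theta> j))
        = (\<Sum>j<N. w j * cosh (\<theta> j) + m * (\<phi> j - \<theta> j))"
      by (simp add: sum.distrib sum_subtractf s \<phi> flip: sum_distrib_left)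
    also have "\<dots> \<le> (\<Sum>j<N. w j * cosh (\<phi> j))" by (intro sum_mono *) simp
    finally show ?thesis .
  qed
  ultimately show ?thesis by blast
qed

lemma cyclic_cost_minimum:
  assumes N: "0 < N" and a: "a \<in> pos_sphere N"
  shows "\<exists>\<theta> \<in> carrier_vec N. (\<Sum>j<N. \<theta> $ j) = \<sigma> \<and>
      cyclic_cost N \<sigma> a = (\<Sum>j<N. a $ j * a $ ((j + 1) mod N) * cosh (\<theta> $ j)) \<and>
      (\<forall>\<phi> \<in> carrier_vec N. (\<Sum>j<N. \<phi> $ j) = \<sigma> \<longrightarrow>
        (\<Sum>j<N. a $ j * a $ ((j + 1) mod N) * cosh (\<theta> $ j))
          \<le> (\<Sum>j<N. a $ j * a $ ((j + 1) mod N) * cosh (\<phi> $ j)))"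
proof -
  let ?f = "\<lambda>\<theta>. \<Sum>j<N. a $ j * a $ ((j + 1) mod N) * cosh (\<theta> j)"
  have "0 < a $ j * a $ ((j + 1) mod N)" if "j < N" for j
    using a that N by (auto simp: pos_sphere_def)
  from weighted_cosh_min_exists[of N "\<lambda>j. a $ j * a $ ((j + 1) mod N)", OF N this]
  obtain t where t: "(\<Sum>j<N. t j) = \<sigma>"
    and min: "\<And>\<phi>. (\<Sum>j<N. \<phi> j) = \<sigma> \<Longrightarrow> ?f t \<le> ?f \<phi>" by blast
  have f: "?f (\<lambda>j. vec N t $ j) = ?f t" "(\<Sum>j<N. vec N t $ j) = \<sigma>" using t by simp_all
  have "cyclic_cost N \<sigma> a = ?f t"
    unfolding cyclic_cost_def
  proof (rule Least_equality)
    show "\<exists>\<theta> \<in> carrier_vec N. (\<Sum>j<N. \<theta> $ j) = \<sigma> \<and> ?f t = ?f (\<lambda>j. \<theta> $ j)"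
      using f by (intro bexI[of _ "vec N t"]) auto
  qed (use min in auto)
  then show ?thesis using f min by (intro bexI[of _ "vec N t"]) auto
qed

lemma cyclic_cost_attained:
  assumes "0 < N" "a \<in> pos_sphere N"
  obtains \<theta> where "\<theta> \<in> carrier_vec N" "(\<Sum>j<N. \<theta> $ j) = \<sigma>"
    "cyclic_cost N \<sigma> a = (\<Sum>j<N. a $ j * a $ ((j + 1) mod N) * cosh (\<theta> $ j))"
  using cyclic_cost_minimum[OF assms] by blast

lemma cyclic_cost_le:
  assumes "0 < N" "a \<in> pos_sphere N" "\<theta> \<in> carrier_vec N" "(\<Sum>j<N. \<theta> $ j) = \<sigma>"
  shows "cyclic_cost N \<sigma> a \<le> (\<Sum>j<N. a $ j * a $ ((j + 1) mod N) * cosh (\<theta> $ j))"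
  using cyclic_cost_minimum[OF assms(1,2), of \<sigma>] assms(3,4) by auto

end

theory Submission
  imports Defs "HOL-Analysis.Function_Topology"
begin

text \<open>
  Let \<open>u\<close> be a positive eigenvector for \<open>\<Lambda> = \<Lambda>\<^sub>p(V)\<close>. For \<open>a\<close> in the positive sphere, weight
  the equation \<open>(\<L>u)\<^sub>j / u\<^sub>j = \<Lambda>\<close> by \<open>a\<^sub>j\<^sup>2\<close> and sum: the two transport terms over each edge \<open>(j, j + 1)\<close>
  combine to \<open>2 d a\<^sub>j a\<^sub>j\<^sub>+\<^sub>1 cosh \<theta>\<^sub>j\<close> with
  \<open>\<theta>\<^sub>j = p + ln (a\<^sub>j\<^sub>+\<^sub>1 / u\<^sub>j\<^sub>+\<^sub>1) - ln (a\<^sub>j / u\<^sub>j)\<close>. These angles telescope to \<open>\<Sum>\<theta>\<^sub>j = N p\<close>, so \<open>\<theta>\<close> is a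
  competitor for the minimum and \<open>\<Lambda>\<close> is an upper bound. If \<open>v\<close> is a positive left eigenvector and
  \<open>a\<^sub>j\<^sup>2\<close> is proportional to \<open>u\<^sub>j v\<^sub>j\<close>, then \<open>a\<^sub>j a\<^sub>j\<^sub>+\<^sub>1 sinh \<theta>\<^sub>j\<close> is the stationary flux, which does not
  depend on \<open>j\<close>; this is the Lagrange condition, so by convexity \<open>\<theta>\<close> is the minimizer and equality
  holds. Positive eigenvectors come from the Collatz-Wielandt principle: the largest \<open>r\<close> with
  \<open>r x \<le> \<L>x\<close> for some \<open>x \<ge> 0\<close>, \<open>x \<noteq> 0\<close> is attained by compactness and is an eigenvalue. The left
  eigenvector is the right one for \<open>- p\<close>.
\<close>

section \<open>Cyclic shifts, and the operator on functions\<close>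

lemma pred_mod_succ:
  fixes j N :: nat
  assumes "j < N"
  shows "((j + 1) mod N + N - 1) mod N = j" "((j + N - 1) mod N + 1) mod N = j"
proof -
  show "((j + 1) mod N + N - 1) mod N = j"
    using assms by (cases "j + 1 = N") auto
  show "((j + N - 1) mod N + 1) mod N = j"
  proof (cases j)
    case 0
    then show ?thesis using assms by auto
  next
    case (Suc i)
    then have "(j + N - 1) mod N = i" using assms by simp
    then show ?thesis using Suc assms by simp
  qed
qed

lemma sum_succ_mod:
  fixes N :: nat and f :: "nat \<Rightarrow> 'a :: comm_monoid_add"
  shows "(\<Sum>j<N. f ((j + 1) mod N)) = (\<Sum>j<N. f j)"
  by (rule sum.reindex_bij_witness[where j = "\<lambda>j. (j + 1) mod N" and i = "\<lambda>j. (j + N - 1) mod N"])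
    (auto simp: pred_mod_succ[simplified])

lemma sum_pred_mod:
  fixes N :: nat and f :: "nat \<Rightarrow> 'a :: comm_monoid_add"
  shows "(\<Sum>j<N. f ((j + N - 1) mod N)) = (\<Sum>j<N. f j)"
  by (rule sum.reindex_bij_witness[where i = "\<lambda>j. (j + 1) mod N" and j = "\<lambda>j. (j + N - 1) mod N"])
    (auto simp: pred_mod_succ[simplified])

text \<open>Separate coefficients \<open>b\<close> and \<open>c\<close> make the transpose an
  instance of the same operator, and the diagonal \<open>q\<close> can absorb scalar shifts.\<close>

definition cyc_op :: "nat \<Rightarrow> real \<Rightarrow> real \<Rightarrow> (nat \<Rightarrow> real) \<Rightarrow> (nat \<Rightarrow> real) \<Rightarrow> nat \<Rightarrow> real" where
  "cyc_op N b c q x j = b * x ((j + 1) mod N) + c * x ((j + N - 1) mod N) + q j * x j"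

text \<open>The forward and backward cyclic shifts are transposes of each other, so \<open>b\<close>
  and \<open>c\<close> trade places.\<close>

lemma cyc_op_adjoint:
  "(\<Sum>j<N. v j * cyc_op N b c q u j) = (\<Sum>j<N. u j * cyc_op N c b q v j)"
proof -
  have 1: "(\<Sum>j<N. v j * u ((j + 1) mod N)) = (\<Sum>j<N. v ((j + N - 1) mod N) * u j)"
    for u v :: "nat \<Rightarrow> real"
    using sum_succ_mod[of "\<lambda>j. v ((j + N - 1) mod N) * u j" N]
    by (simp add: pred_mod_succ[simplified])
  have "(\<Sum>j<N. v j * cyc_op N b c q u j)
      = b * (\<Sum>j<N. v j * u ((j + 1) mod N)) + c * (\<Sum>j<N. v j * u ((j + N - 1) mod N))
        + (\<Sum>j<N. q j * v j * u j)"
    by (simp add: cyc_op_def sum.distrib sum_distrib_left algebra_simps)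
  also have "\<dots> = b * (\<Sum>j<N. v ((j + N - 1) mod N) * u j)
      + c * (\<Sum>j<N. v ((j + 1) mod N) * u j) + (\<Sum>j<N. q j * v j * u j)"
    using 1[of v u] 1[of u v] by (simp add: mult.commute)
  also have "\<dots> = (\<Sum>j<N. u j * cyc_op N c b q v j)"
    by (simp add: cyc_op_def sum.distrib sum_distrib_left algebra_simps)
  finally show ?thesis .
qed

text \<open>In each iteration \<open>b\<close> carries positivity from \<open>j + 1\<close> to
  \<open>j\<close>, and the positive diagonal preserves what is already positive.\<close>

lemma cyc_op_iterate_pos:
  assumes b: "0 < b" and c: "0 \<le> c" and q: "\<And>j. j < N \<Longrightarrow> 0 < q j"
    and x: "\<And>j. j < N \<Longrightarrow> 0 \<le> x j" and j: "j < N"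
  shows "0 \<le> (cyc_op N b c q ^^ n) x j"
    and "m \<le> n \<Longrightarrow> 0 < x ((j + m) mod N) \<Longrightarrow> 0 < (cyc_op N b c q ^^ n) x j"
proof -
  have "0 \<le> (cyc_op N b c q ^^ n) x j \<and>
    (\<forall>m\<le>n. 0 < x ((j + m) mod N) \<longrightarrow> 0 < (cyc_op N b c q ^^ n) x j)"
    using j
  proof (induction n arbitrary: j)
    case 0
    then show ?case using x by simp
  next
    case (Suc n)
    let ?y = "(cyc_op N b c q ^^ n) x"
    have lt: "(j + 1) mod N < N" "(j + N - 1) mod N < N" using Suc.prems by auto
    have nn: "0 \<le> b * ?y ((j + 1) mod N)" "0 \<le> c * ?y ((j + N - 1) mod N)" "0 \<le> q j * ?y j"
      using Suc.IH[OF lt(1)] Suc.IH[OF lt(2)] Suc.IH[OF Suc.prems] b c q[OF Suc.prems]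
      by (intro mult_nonneg_nonneg; linarith)+
    have eq: "(cyc_op N b c q ^^ Suc n) x j
      = b * ?y ((j + 1) mod N) + c * ?y ((j + N - 1) mod N) + q j * ?y j"
      by (simp add: cyc_op_def)
    have "0 < (cyc_op N b c q ^^ Suc n) x j" if m: "m \<le> Suc n" "0 < x ((j + m) mod N)" for m
    proof (cases m)
      case 0
      then have "0 < ?y j" using Suc.IH[OF Suc.prems] m by auto
      then have "0 < q j * ?y j" using q[OF Suc.prems] by simp
      then show ?thesis unfolding eq using nn by linarith
    next
      case (Suc k)
      then have "0 < x (((j + 1) mod N + k) mod N)" using m by (simp add: mod_add_left_eq)
      then have "0 < ?y ((j + 1) mod N)" using Suc.IH[OF lt(1)] m Suc by auto
      then have "0 < b * ?y ((j + 1) mod N)" using b by simp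
      then show ?thesis unfolding eq using nn by linarith
    qed
    then show ?case using eq nn by auto
  qed
  then show "0 \<le> (cyc_op N b c q ^^ n) x j"
    and "m \<le> n \<Longrightarrow> 0 < x ((j + m) mod N) \<Longrightarrow> 0 < (cyc_op N b c q ^^ n) x j" by auto
qed

lemma cyc_op_iterate_pos_all:
  assumes "0 < b" "0 \<le> c" "\<And>j. j < N \<Longrightarrow> 0 < q j" "\<And>j. j < N \<Longrightarrow> 0 \<le> x j"
    and "k < N" "0 < x k" "j < N"
  shows "0 < (cyc_op N b c q ^^ N) x j"
proof -
  \<comment> \<open>The forward distance from \<open>j\<close> to \<open>k\<close> around the cycle;
    adding \<open>N\<close> avoids truncated subtraction.\<close>
  let ?m = "if j \<le> k then k - j else k + N - j"
  have "(j + ?m) mod N = k" "?m \<le> N" using assms by auto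
  then show ?thesis using cyc_op_iterate_pos(2)[of b c N q x j ?m N] assms by auto
qed

text \<open>Adding \<open>M\<close> times the identity yields an operator that commutes with the
  original one, so its powers can be applied to the slack of a sub-eigenvector.\<close>

lemma cyc_op_iterate_shift:
  assumes q': "\<And>j. q' j = M + q j"
  shows "(cyc_op N b c q' ^^ n) (\<lambda>i. cyc_op N b c q x i - r * x i)
    = (\<lambda>j. cyc_op N b c q ((cyc_op N b c q' ^^ n) x) j - r * (cyc_op N b c q' ^^ n) x j)"
proof (induction n)
  case (Suc n)
  have "cyc_op N b c q' (\<lambda>i. cyc_op N b c q y i - r * y i)
      = (\<lambda>j. cyc_op N b c q (cyc_op N b c q' y) j - r * cyc_op N b c q' y j)" for y
    by (simp add: fun_eq_iff cyc_op_def q' algebra_simps)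
  then show ?case by (simp add: Suc)
qed simp

section \<open>Positive eigenvectors by Collatz-Wielandt maximization\<close>

lemma cyc_op_subeigen_bound:
  assumes "0 \<le> b" "0 \<le> c"
    and x: "\<And>j. j < N \<Longrightarrow> 0 \<le> x j" "(\<Sum>j<N. x j) = 1"
    and r: "\<And>j. j < N \<Longrightarrow> r * x j \<le> cyc_op N b c q x j"
  shows "r \<le> b + c + (\<Sum>j<N. \<bar>q j\<bar>)"
proof -
  have x1: "x j \<le> 1" if "j < N" for j
    using member_le_sum[of j "{..<N}" x] x that by auto
  have "r = (\<Sum>j<N. r * x j)" by (simp add: x flip: sum_distrib_left)
  also have "\<dots> \<le> (\<Sum>j<N. cyc_op N b c q x j)" by (intro sum_mono r) simp
  also have "\<dots> = b * (\<Sum>j<N. x ((j + 1) mod N)) + c * (\<Sum>j<N. x ((j + N - 1) mod N))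
      + (\<Sum>j<N. q j * x j)"
    by (simp add: cyc_op_def sum.distrib sum_distrib_left)
  \<comment> \<open>Both shifts preserve the total mass 1, so the neighbour terms contribute exactly
    \<open>b + c\<close>.\<close>
  also have "\<dots> = b + c + (\<Sum>j<N. q j * x j)"
    unfolding sum_succ_mod sum_pred_mod x(2) by simp
  also have "(\<Sum>j<N. q j * x j) \<le> (\<Sum>j<N. \<bar>q j\<bar>)"
  proof (rule sum_mono)
    fix j assume "j \<in> {..<N}"
    then have "0 \<le> x j" "x j \<le> 1" using x(1) x1 by auto
    then have "\<bar>q j\<bar> * x j \<le> \<bar>q j\<bar> * 1" "q j * x j \<le> \<bar>q j\<bar> * x j"
      by (intro mult_left_mono mult_right_mono; simp)+
    then show "q j * x j \<le> \<bar>q j\<bar>" by linarith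
  qed
  finally show ?thesis by simp
qed

lemma cyc_op_maximal_subeigen:
  assumes N: "0 < N" and bc: "0 \<le> b" "0 \<le> c"
  obtains r x where "(\<Sum>j<N. x j) = 1" "\<And>j. j < N \<Longrightarrow> 0 \<le> x j"
    "\<And>j. j < N \<Longrightarrow> r * x j \<le> cyc_op N b c q x j"
    "\<And>s y. (\<And>j. j < N \<Longrightarrow> 0 \<le> y j) \<Longrightarrow> (\<Sum>j<N. y j) = 1 \<Longrightarrow>
      (\<And>j. j < N \<Longrightarrow> s * y j \<le> cyc_op N b c q y j) \<Longrightarrow> s \<le> r"
proof -
  let ?S = "\<Sum>j<N. \<bar>q j\<bar>"
  \<comment> \<open>The admissible pairs \<open>(r, x)\<close>. Since \<open>x\<close> is a function
    on all naturals, the box for it is an infinite product, compact by Tychonoff. The upper bound on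
    \<open>r\<close> comes from \<open>cyc_op_subeigen_bound\<close>; the lower one is reached by
    the constant vector below.\<close>
  define K where "K = ({- ?S..b + c + ?S} \<times> (\<Pi>\<^sub>E j\<in>(UNIV :: nat set). {0..1 :: real})) \<inter>
     ({z. (\<Sum>j<N. snd z j) = 1} \<inter> (\<Inter>j\<in>{..<N}. {z. fst z * snd z j \<le> cyc_op N b c q (snd z) j}))"
  have coord: "continuous_on UNIV (\<lambda>z :: real \<times> (nat \<Rightarrow> real). snd z j)" for j
    by (rule continuous_on_product_then_coordinatewise) (intro continuous_intros)
  have "compact (\<Pi>\<^sub>E j\<in>(UNIV :: nat set). {0..1 :: real})"
    using compactin_PiE[of "\<lambda>_. euclidean" "UNIV :: nat set" "\<lambda>_. {0..1 :: real}"]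
    by (simp add: euclidean_product_topology)
  moreover have "closed ({z. (\<Sum>j<N. snd z j) = 1} \<inter>
      (\<Inter>j\<in>{..<N}. {z :: real \<times> (nat \<Rightarrow> real). fst z * snd z j \<le> cyc_op N b c q (snd z) j}))"
    unfolding cyc_op_def
    by (intro closed_Int closed_INT ballI closed_Collect_le closed_Collect_eq continuous_intros coord)
  ultimately have K: "compact K"
    unfolding K_def by (intro compact_Int_closed compact_Times) auto
  \<comment> \<open>Values of \<open>y\<close> beyond the cycle are arbitrary; cutting them to 0
    puts \<open>y\<close> into the box and leaves the constraints unchanged.\<close>
  have mem: "(s, \<lambda>j. if j < N then y j else 0) \<in> K"
    if s: "- ?S \<le> s" and y: "\<And>j. j < N \<Longrightarrow> 0 \<le> y j" "(\<Sum>j<N. y j) = 1"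
      "\<And>j. j < N \<Longrightarrow> s * y j \<le> cyc_op N b c q y j" for s y
  proof -
    have "y j \<le> 1" if "j < N" for j using member_le_sum[of j "{..<N}" y] y that by auto
    moreover have "s \<le> b + c + ?S" using cyc_op_subeigen_bound[OF bc] y by blast
    ultimately show ?thesis using s y N by (auto simp: K_def cyc_op_def)
  qed
  have "(- ?S, \<lambda>j. if j < N then 1 / real N else 0) \<in> K"
  proof (rule mem)
    fix j assume j: "j < N"
    have "\<bar>q j\<bar> \<le> ?S" using j member_le_sum[of j "{..<N}" "\<lambda>j. \<bar>q j\<bar>"] by auto
    then have "- ?S \<le> b + c + q j" using bc by linarith
    then show "- ?S * (1 / real N) \<le> cyc_op N b c q (\<lambda>_. 1 / real N) j"
      using N by (simp add: cyc_op_def field_simps)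
  qed (use N in simp_all)
  then have ne: "K \<noteq> {}" by auto
  have "compact (fst ` K)" by (rule compact_continuous_image[OF _ K]) (intro continuous_intros)
  then obtain r where r: "r \<in> fst ` K" "\<And>s. s \<in> fst ` K \<Longrightarrow> s \<le> r"
    using compact_attains_sup[of "fst ` K"] ne by auto
  then obtain x where x: "(r, x) \<in> K" by auto
  show ?thesis
  proof (rule that[of x r])
    show "s \<le> r" if "\<And>j. j < N \<Longrightarrow> 0 \<le> y j" "(\<Sum>j<N. y j) = 1"
      "\<And>j. j < N \<Longrightarrow> s * y j \<le> cyc_op N b c q y j" for s y
    proof (cases "- ?S \<le> s")
      case True
      then show ?thesis using r(2)[of s] mem[OF True that] by force
    next
      \<comment> \<open>Here \<open>s\<close> lies below the lower end of the interval containing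
        \<open>r\<close>.\<close>
      case False
      then show ?thesis using x by (auto simp: K_def)
    qed
  qed (use x in \<open>auto simp: K_def PiE_iff\<close>)
qed

lemma cyc_op_Perron:
  assumes N: "0 < N" and b: "0 < b" and c: "0 \<le> c"
  obtains r u where "\<And>j. j < N \<Longrightarrow> 0 < u j" "\<And>j. j < N \<Longrightarrow> cyc_op N b c q u j = r * u j"
proof -
  obtain r x where x: "(\<Sum>j<N. x j) = 1" "\<And>j. j < N \<Longrightarrow> 0 \<le> x j"
    and rx: "\<And>j. j < N \<Longrightarrow> r * x j \<le> cyc_op N b c q x j"
    and max: "\<And>s y. (\<And>j. j < N \<Longrightarrow> 0 \<le> y j) \<Longrightarrow> (\<Sum>j<N. y j) = 1 \<Longrightarrow>
      (\<And>j. j < N \<Longrightarrow> s * y j \<le> cyc_op N b c q y j) \<Longrightarrow> s \<le> r"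
    by (rule cyc_op_maximal_subeigen[where q = q, OF N less_imp_le[OF b] c], rule that, assumption) blast+
  obtain k where k: "k < N" "0 < x k"
    using x sum_nonpos[of "{..<N}" x] by (force simp: not_less)
  have eigen: "cyc_op N b c q x j = r * x j" if j: "j < N" for j
  proof (rule ccontr)
    assume "cyc_op N b c q x j \<noteq> r * x j"
    then have gap: "0 < cyc_op N b c q x j - r * x j" using rx[OF j] by simp
    txt \<open>
      A power of a positive shift of the operator commutes with it and turns the slack at \<open>j\<close> into
      slack everywhere, leaving room to increase \<open>r\<close>.
    \<close>
    define M where "M = 1 + (\<Sum>j<N. \<bar>q j\<bar>)"
    let ?Q = "cyc_op N b c (\<lambda>j. M + q j) ^^ N"
    define z where "z = ?Q x"
    have q: "0 < M + q i" if "i < N" for i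
      using that member_le_sum[of i "{..<N}" "\<lambda>j. \<bar>q j\<bar>"] by (auto simp: M_def)
    have z: "0 < z i" if "i < N" for i
      unfolding z_def by (rule cyc_op_iterate_pos_all[OF b c _ _ k(1) _ that]) (use q x k in auto)
    have g: "0 < cyc_op N b c q z i - r * z i" if "i < N" for i
    proof -
      have "0 < ?Q (\<lambda>i. cyc_op N b c q x i - r * x i) i"
        by (rule cyc_op_iterate_pos_all[OF b c _ _ j _ that]) (use q rx gap in auto)
      then show ?thesis
        by (simp add: cyc_op_iterate_shift[where q = q and M = M] z_def)
    qed
    \<comment> \<open>The least relative slack of \<open>z\<close>: at every site \<open>r\<close>
      can be raised by this amount.\<close>
    define e where "e = Min ((\<lambda>i. (cyc_op N b c q z i - r * z i) / z i) ` {..<N})"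
    have e: "0 < e" unfolding e_def using N z g by (subst Min_gr_iff) auto
    have e_le: "(r + e) * z i \<le> cyc_op N b c q z i" if "i < N" for i
    proof -
      have "e \<le> (cyc_op N b c q z i - r * z i) / z i" unfolding e_def using that by (intro Min_le) auto
      then show ?thesis using z[OF that] by (simp add: field_simps)
    qed
    define S where "S = (\<Sum>i<N. z i)"
    have S: "0 < S" unfolding S_def using N z by (intro sum_pos) auto
    \<comment> \<open>Normalizing \<open>z\<close> to total mass 1 makes it a competitor and
      contradicts maximality.\<close>
    have "r + e \<le> r"
    proof (rule max[where y = "\<lambda>i. z i / S"])
      show "(\<Sum>i<N. z i / S) = 1" using S by (simp add: S_def flip: sum_divide_distrib)
      fix i assume i: "i < N"
      show "0 \<le> z i / S" using z[OF i] S by simp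
      have "cyc_op N b c q (\<lambda>i. z i / S) i = cyc_op N b c q z i / S"
        by (simp add: cyc_op_def add_divide_distrib)
      then show "(r + e) * (z i / S) \<le> cyc_op N b c q (\<lambda>i. z i / S) i"
        using e_le[OF i] S by (simp add: divide_right_mono)
    qed
    then show False using e by simp
  qed
  have pos: "0 < x j" if j: "j < N" for j
  proof (rule ccontr)
    assume "\<not> 0 < x j"
    then have x0: "x j = 0" using x(2)[OF j] by simp
    \<comment> \<open>At a zero of \<open>x\<close> the eigenvalue equation leaves a vanishing sum
      of nonnegative neighbour terms, so the zero moves one site forward and eventually reaches
      \<open>k\<close>.\<close>
    have "x ((j + m) mod N) = 0" for m
    proof (induction m)
      case 0
      then show ?case using x0 j by simp
    next
      case (Suc m)
      let ?i = "(j + m) mod N"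
      have i: "?i < N" using N by simp
      have "b * x ((?i + 1) mod N) + c * x ((?i + N - 1) mod N) = 0"
        using eigen[OF i] Suc by (simp add: cyc_op_def)
      moreover have "0 \<le> b * x ((?i + 1) mod N)" "0 \<le> c * x ((?i + N - 1) mod N)"
        using b c x(2) N by simp_all
      ultimately have "b * x ((?i + 1) mod N) = 0" by linarith
      then show ?case using b by (simp add: mod_Suc_eq)
    qed
    from this[of "k + N - j"] show False using k j by simp
  qed
  show ?thesis using pos eigen that by blast
qed

section \<open>Identification of the principal eigenvalue\<close>

lemma advection_op_cyc_op:
  "advection_op N d p V u = vec N (cyc_op N (d * exp (- p)) (d * exp p) (\<lambda>j. V $ j - 2 * d) (($) u))"
  by (auto simp: advection_op_def cyc_op_def algebra_simps)

text \<open>Pairing the right eigenvector with the left one gives the same number with factor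
  \<open>r\<close> and with factor \<open>s\<close>, and the pairing is positive.\<close>

lemma cyc_op_eigen_adjoint_eq:
  assumes N: "0 < N"
    and u: "\<And>j. j < N \<Longrightarrow> 0 < u j" "\<And>j. j < N \<Longrightarrow> cyc_op N b c q u j = r * u j"
    and v: "\<And>j. j < N \<Longrightarrow> 0 < v j" "\<And>j. j < N \<Longrightarrow> cyc_op N c b q v j = s * v j"
  shows "r = s"
proof -
  have "0 < (\<Sum>j<N. v j * u j)" using N u v by (intro sum_pos) auto
  moreover have "r * (\<Sum>j<N. v j * u j) = s * (\<Sum>j<N. v j * u j)"
    using cyc_op_adjoint[of v N b c q u] u v by (simp add: sum_distrib_left algebra_simps)
  ultimately show ?thesis by simp
qed

text \<open>The moduli of a complex eigenvector satisfy the sub-eigenvector inequality with factor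
  \<open>Re k\<close>; testing it against the positive left eigenvector \<open>v\<close> compares
  \<open>Re k\<close> with \<open>r\<close>.\<close>

lemma cyc_op_eigenvalue_Re_le:
  fixes w :: "nat \<Rightarrow> complex"
  assumes bc: "0 \<le> b" "0 \<le> c"
    and v: "\<And>j. j < N \<Longrightarrow> 0 < v j" "\<And>j. j < N \<Longrightarrow> cyc_op N c b q v j = r * v j"
    and w: "\<And>j. j < N \<Longrightarrow> of_real b * w ((j + 1) mod N) + of_real c * w ((j + N - 1) mod N)
        + of_real (q j) * w j = k * w j"
    and nz: "i < N" "w i \<noteq> 0"
  shows "Re k \<le> r"
proof -
  have *: "Re k * cmod (w j) \<le> cyc_op N b c q (\<lambda>j. cmod (w j)) j" if j: "j < N" for j
  proof -
    \<comment> \<open>The diagonal is moved to the eigenvalue side before taking moduli, since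
      \<open>q j\<close> may be negative.\<close>
    have "Re k - q j \<le> cmod (k - of_real (q j))" using complex_Re_le_cmod[of "k - of_real (q j)"] by simp
    then have "(Re k - q j) * cmod (w j) \<le> cmod ((k - of_real (q j)) * w j)"
      by (simp add: norm_mult mult_right_mono)
    also have "(k - of_real (q j)) * w j
        = of_real b * w ((j + 1) mod N) + of_real c * w ((j + N - 1) mod N)"
      using w[OF j] by (simp add: algebra_simps)
    also have "cmod \<dots> \<le> b * cmod (w ((j + 1) mod N)) + c * cmod (w ((j + N - 1) mod N))"
      using bc by (intro order_trans[OF norm_triangle_ineq]) (simp add: norm_mult)
    finally show ?thesis by (simp add: cyc_op_def algebra_simps)
  qed
  let ?s = "\<Sum>j<N. v j * cmod (w j)"
  have "Re k * ?s = (\<Sum>j<N. v j * (Re k * cmod (w j)))" by (simp add: sum_distrib_left algebra_simps)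
  also have "\<dots> \<le> (\<Sum>j<N. v j * cyc_op N b c q (\<lambda>j. cmod (w j)) j)"
    using * v(1) by (intro sum_mono mult_left_mono) (auto simp: less_imp_le)
  also have "\<dots> = r * ?s"
    unfolding cyc_op_adjoint[of v] by (simp add: v sum_distrib_left algebra_simps)
  finally have "Re k * ?s \<le> r * ?s" .
  moreover have "0 < ?s" using v(1) nz by (intro sum_pos2[of _ i]) (auto simp: less_imp_le)
  ultimately show ?thesis by simp
qed

text \<open>Splitting into real and imaginary parts makes the formula for the real operator
  available for complex vectors.\<close>

lemma mult_mat_vec_complex_of_real:
  assumes A: "A \<in> carrier_mat n m" and w: "w \<in> carrier_vec m"
  shows "map_mat complex_of_real A *\<^sub>v w
    = vec n (\<lambda>j. Complex ((A *\<^sub>v map_vec Re w) $ j) ((A *\<^sub>v map_vec Im w) $ j))"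
  using A w by (intro eq_vecI) (auto simp: scalar_prod_def complex_eq_iff)

text \<open>The vector \<open>u\<close> puts \<open>r\<close> into the spectrum, and
  \<open>v\<close> bounds the real part of every eigenvalue by \<open>r\<close>.\<close>

lemma principal_eigenvalue_eqI:
  assumes N: "0 < N" and d: "0 < d"
    and u: "\<And>j. j < N \<Longrightarrow> 0 < u j"
      "\<And>j. j < N \<Longrightarrow> cyc_op N (d * exp (- p)) (d * exp p) (\<lambda>j. V $ j - 2 * d) u j = r * u j"
    and v: "\<And>j. j < N \<Longrightarrow> 0 < v j"
      "\<And>j. j < N \<Longrightarrow> cyc_op N (d * exp p) (d * exp (- p)) (\<lambda>j. V $ j - 2 * d) v j = r * v j"
  shows "principal_eigenvalue N d p V = r"
proof -
  let ?A = "matrix_of_op N (advection_op N d p V)"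
  let ?C = "map_mat complex_of_real ?A"
  have A: "?A \<in> carrier_mat N N" by (simp add: matrix_of_op_def)
  have C: "(?C *\<^sub>v w) $ j = of_real (d * exp (- p)) * w $ ((j + 1) mod N)
        + of_real (d * exp p) * w $ ((j + N - 1) mod N) + of_real (V $ j - 2 * d) * w $ j"
    if w: "w \<in> carrier_vec N" and j: "j < N" for w j
  proof -
    have lt: "(j + 1) mod N < dim_vec w" "(j + N - 1) mod N < dim_vec w" "j < dim_vec w"
      using w j by auto
    show ?thesis
      using w j lt
      by (simp add: mult_mat_vec_complex_of_real[OF A] matrix_of_advection_op advection_op_cyc_op
          cyc_op_def complex_eq_iff)
  qed
  have dim: "dim_row ?C = N" using A by simp
  have "eigenvalue ?C (of_real r)"
    unfolding eigenvalue_def eigenvector_def dim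
  proof (intro exI[of _ "vec N (\<lambda>j. of_real (u j))"] conjI)
    have "vec N (\<lambda>j. complex_of_real (u j)) $ 0 \<noteq> 0\<^sub>v N $ 0" using u(1)[of 0] N by simp
    then show "vec N (\<lambda>j. complex_of_real (u j)) \<noteq> 0\<^sub>v N" by metis
    show "?C *\<^sub>v vec N (\<lambda>j. of_real (u j)) = of_real r \<cdot>\<^sub>v vec N (\<lambda>j. of_real (u j))"
    proof (rule eq_vecI)
      fix j assume "j < dim_vec (of_real r \<cdot>\<^sub>v vec N (\<lambda>j. complex_of_real (u j)))"
      then have j: "j < N" by simp
      have "complex_of_real (cyc_op N (d * exp (- p)) (d * exp p) (\<lambda>j. V $ j - 2 * d) u j)
        = of_real (r * u j)"
        using u(2)[OF j] by simp
      then show "(?C *\<^sub>v vec N (\<lambda>j. of_real (u j))) $ j = (of_real r \<cdot>\<^sub>v vec N (\<lambda>j. complex_of_real (u j))) $ j"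
        using j N by (subst C) (simp_all add: cyc_op_def)
    qed (use A in simp)
  qed simp
  then have ge: "r \<le> spectral_bound ?A"
    using spectral_bound_props(2)[OF A N, of "of_real r"] by simp
  obtain k where k: "eigenvalue ?C k" "Re k = spectral_bound ?A"
    using spectral_bound_props(1)[OF A N] by blast
  then obtain w where w: "w \<in> carrier_vec N" "w \<noteq> 0\<^sub>v N" "?C *\<^sub>v w = k \<cdot>\<^sub>v w"
    unfolding eigenvalue_def eigenvector_def dim by blast
  then obtain i where i: "i < N" "w $ i \<noteq> 0" by (metis carrier_vecD eq_vecI index_zero_vec)
  have "Re k \<le> r"
  proof (rule cyc_op_eigenvalue_Re_le[of "d * exp (- p)" "d * exp p" N v _ r "($) w" k i])
    fix j assume j: "j < N"
    show "of_real (d * exp (- p)) * w $ ((j + 1) mod N)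
        + of_real (d * exp p) * w $ ((j + N - 1) mod N) + of_real (V $ j - 2 * d) * w $ j = k * w $ j"
      using C[OF w(1) j] w(1) j by (simp add: w(3))
  qed (use d v i in auto)
  then show ?thesis using ge k(2) by (simp add: principal_eigenvalue_def)
qed

section \<open>Edge angles and the eigenvalue as a weighted cosh sum\<close>

definition tilt :: "nat \<Rightarrow> real \<Rightarrow> (nat \<Rightarrow> real) \<Rightarrow> nat \<Rightarrow> real" where
  "tilt N p h j = p + ln (h ((j + 1) mod N)) - ln (h j)"

lemma sum_tilt: "(\<Sum>j<N. tilt N p h j) = real N * p"
  using sum_succ_mod[of "\<lambda>j. ln (h j)" N] by (simp add: tilt_def sum.distrib sum_subtractf)

lemma exp_tilt:
  assumes "j < N" "\<And>j. j < N \<Longrightarrow> 0 < h j"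
  shows "exp (tilt N p h j) = exp p * h ((j + 1) mod N) / h j"
    "exp (- tilt N p h j) = exp (- p) * h j / h ((j + 1) mod N)"
proof -
  have "0 < h j" "0 < h ((j + 1) mod N)" using assms by auto
  then show "exp (tilt N p h j) = exp p * h ((j + 1) mod N) / h j"
    "exp (- tilt N p h j) = exp (- p) * h j / h ((j + 1) mod N)"
    by (simp_all add: tilt_def exp_add exp_diff exp_minus field_simps)
qed

text \<open>The ratio of neighbouring \<open>a\<close> in \<open>exp (\<theta> j)\<close> turns the
  product weight into a square. The two exponentials are thus the transport terms of one edge: cosh
  takes their sum, sinh their difference.\<close>

lemma tilt_cosh_sinh:
  fixes p :: real
  assumes j: "j < N" and u: "\<And>j. j < N \<Longrightarrow> 0 < u j" and a: "\<And>j. j < N \<Longrightarrow> 0 < a j"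
  defines "\<theta> \<equiv> tilt N p (\<lambda>j. a j / u j)"
  shows "2 * (a j * a ((j + 1) mod N) * cosh (\<theta> j))
      = exp p * (a ((j + 1) mod N))\<^sup>2 * u j / u ((j + 1) mod N)
        + exp (- p) * (a j)\<^sup>2 * u ((j + 1) mod N) / u j"
    and "2 * (a j * a ((j + 1) mod N) * sinh (\<theta> j))
      = exp p * (a ((j + 1) mod N))\<^sup>2 * u j / u ((j + 1) mod N)
        - exp (- p) * (a j)\<^sup>2 * u ((j + 1) mod N) / u j"
proof -
  let ?j = "(j + 1) mod N"
  have pos: "0 < u j" "0 < u ?j" "0 < a j" "0 < a ?j" using assms by auto
  have e: "exp (\<theta> j) = exp p * (a ?j / u ?j) / (a j / u j)"
    "exp (- \<theta> j) = exp (- p) * (a j / u j) / (a ?j / u ?j)"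
    unfolding \<theta>_def using exp_tilt[OF j, of "\<lambda>j. a j / u j" p] u a by auto
  have "a j * a ?j * exp (\<theta> j) = exp p * (a ?j)\<^sup>2 * u j / u ?j"
    "a j * a ?j * exp (- \<theta> j) = exp (- p) * (a j)\<^sup>2 * u ?j / u j"
    unfolding e using pos by (simp_all add: power2_eq_square)
  then show "2 * (a j * a ?j * cosh (\<theta> j))
      = exp p * (a ?j)\<^sup>2 * u j / u ?j + exp (- p) * (a j)\<^sup>2 * u ?j / u j"
    "2 * (a j * a ?j * sinh (\<theta> j))
      = exp p * (a ?j)\<^sup>2 * u j / u ?j - exp (- p) * (a j)\<^sup>2 * u ?j / u j"
    by (simp_all add: cosh_def sinh_def algebra_simps)
qed

lemma eigenvalue_tilt:
  assumes u: "\<And>j. j < N \<Longrightarrow> 0 < u j"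
      "\<And>j. j < N \<Longrightarrow> cyc_op N (d * exp (- p)) (d * exp p) (\<lambda>j. V $ j - 2 * d) u j = r * u j"
    and a: "\<And>j. j < N \<Longrightarrow> 0 < a j" "(\<Sum>j<N. (a j)\<^sup>2) = 1"
  shows "r = 2 * d * (\<Sum>j<N. a j * a ((j + 1) mod N) * cosh (tilt N p (\<lambda>j. a j / u j) j)) - 2 * d
      + (\<Sum>j<N. V $ j * (a j)\<^sup>2)"
proof -
  let ?s = "\<lambda>j. (j + 1) mod N" and ?p = "\<lambda>j. (j + N - 1) mod N"
  let ?f = "\<lambda>i j. (a j)\<^sup>2 * u i / u j"
  have d: "(\<Sum>j<N. 2 * (d * (a j)\<^sup>2)) = 2 * d" by (simp add: a flip: sum_distrib_left)
  have "r = (\<Sum>j<N. (a j)\<^sup>2 / u j * (r * u j))"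
  proof -
    have "(\<Sum>j<N. (a j)\<^sup>2 / u j * (r * u j)) = (\<Sum>j<N. r * (a j)\<^sup>2)"
      by (rule sum.cong) (use u(1) in force)+
    then show ?thesis by (simp add: a flip: sum_distrib_left)
  qed
  also have "\<dots> = (\<Sum>j<N. (a j)\<^sup>2 / u j
      * cyc_op N (d * exp (- p)) (d * exp p) (\<lambda>j. V $ j - 2 * d) u j)"
    using u(2) by simp
  also have "\<dots> = (\<Sum>j<N. d * exp (- p) * ?f (?s j) j + d * exp p * ?f (?p j) j
      + V $ j * (a j)\<^sup>2 - 2 * d * (a j)\<^sup>2)"
  proof (rule sum.cong)
    fix j assume "j \<in> {..<N}"
    then have "u j \<noteq> 0" using u(1)[of j] by simp
    then show "(a j)\<^sup>2 / u j * cyc_op N (d * exp (- p)) (d * exp p) (\<lambda>j. V $ j - 2 * d) u j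
      = d * exp (- p) * ?f (?s j) j + d * exp p * ?f (?p j) j + V $ j * (a j)\<^sup>2 - 2 * d * (a j)\<^sup>2"
      by (simp add: cyc_op_def field_simps)
  qed simp
  also have "\<dots> = d * (\<Sum>j<N. exp (- p) * ?f (?s j) j) + d * (\<Sum>j<N. exp p * ?f (?p j) j)
      + (\<Sum>j<N. V $ j * (a j)\<^sup>2) - 2 * d"
    using d by (simp add: sum.distrib sum_subtractf mult.assoc sum_distrib_left)
  \<comment> \<open>Reindexing assigns the backward term at \<open>j + 1\<close> to the edge from
    \<open>j\<close> to \<open>j + 1\<close>, where it meets the forward term at
    \<open>j\<close>.\<close>
  also have "(\<Sum>j<N. exp p * ?f (?p j) j) = (\<Sum>j<N. exp p * ?f j (?s j))"
    using sum_succ_mod[of "\<lambda>j. exp p * ?f (?p j) j" N] by (simp add: pred_mod_succ[simplified])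
  also have "d * (\<Sum>j<N. exp (- p) * ?f (?s j) j) + d * (\<Sum>j<N. exp p * ?f j (?s j))
      = d * (\<Sum>j<N. 2 * (a j * a (?s j) * cosh (tilt N p (\<lambda>j. a j / u j) j)))"
    unfolding distrib_left[symmetric] sum.distrib[symmetric]
  proof (intro arg_cong[of _ _ "(*) d"] sum.cong refl)
    fix j assume "j \<in> {..<N}"
    then have j: "j < N" by simp
    show "exp (- p) * ?f (?s j) j + exp p * ?f j (?s j)
        = 2 * (a j * a (?s j) * cosh (tilt N p (\<lambda>j. a j / u j) j))"
      by (subst tilt_cosh_sinh(1)[OF j u(1) a(1)]) (simp_all add: mult.assoc)
  qed
  finally show ?thesis unfolding sum_distrib_left[symmetric, of 2] by simp
qed

section \<open>Optimality through a constant flux\<close>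

lemma weighted_cosh_sum_le:
  fixes w :: "nat \<Rightarrow> real"
  assumes w: "\<And>j. j < N \<Longrightarrow> 0 \<le> w j"
    and m: "\<And>j. j < N \<Longrightarrow> w j * sinh (\<theta> j) = m"
    and s: "(\<Sum>j<N. \<theta> j) = (\<Sum>j<N. \<phi> j)"
  shows "(\<Sum>j<N. w j * cosh (\<theta> j)) \<le> (\<Sum>j<N. w j * cosh (\<phi> j))"
proof -
  \<comment> \<open>The tangent line of cosh at \<open>\<theta> j\<close> has weighted slope
    \<open>m\<close> for every \<open>j\<close>, so the linear terms cancel in the sum because the
    totals agree.\<close>
  have *: "w j * cosh (\<theta> j) + m * (\<phi> j - \<theta> j) \<le> w j * cosh (\<phi> j)" if j: "j < N" for j
  proof -
    have "w j * (cosh (\<theta> j) + sinh (\<theta> j) * (\<phi> j - \<theta> j)) \<le> w j * cosh (\<phi> j)"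
      using cosh_tangent w[OF j] by (intro mult_left_mono) auto
    then show ?thesis using m[OF j] by (simp add: distrib_left flip: mult.assoc)
  qed
  have "(\<Sum>j<N. w j * cosh (\<theta> j)) = (\<Sum>j<N. w j * cosh (\<theta> j) + m * (\<phi> j - \<theta> j))"
    by (simp add: sum.distrib sum_subtractf s flip: sum_distrib_left)
  also have "\<dots> \<le> (\<Sum>j<N. w j * cosh (\<phi> j))" by (intro sum_mono *) simp
  finally show ?thesis .
qed

text \<open>Multiplying the two eigenvalue equations at a site crosswise by \<open>v\<close> and
  \<open>u\<close> cancels diagonal and eigenvalue; what remains says that the flux into the site
  equals the flux out of it.\<close>

lemma cyc_op_flux_const:
  assumes u: "\<And>j. j < N \<Longrightarrow> cyc_op N b c q u j = r * u j"
    and v: "\<And>j. j < N \<Longrightarrow> cyc_op N c b q v j = r * v j"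
    and "j < N"
  shows "c * v ((j + 1) mod N) * u j - b * v j * u ((j + 1) mod N)
    = c * v (1 mod N) * u 0 - b * v 0 * u (1 mod N)"
  using \<open>j < N\<close>
proof (induction j)
  case (Suc j)
  let ?k = "Suc j"
  have k: "?k mod N = ?k" "(?k + N - 1) mod N = j" using Suc.prems by auto
  have "v ?k * cyc_op N b c q u ?k = u ?k * cyc_op N c b q v ?k"
    using u[OF Suc.prems] v[OF Suc.prems] by simp
  then have "v ?k * (b * u ((?k + 1) mod N) + c * u j) = u ?k * (c * v ((?k + 1) mod N) + b * v j)"
    unfolding cyc_op_def k by (simp add: algebra_simps)
  then have "c * v ((?k + 1) mod N) * u ?k - b * v ?k * u ((?k + 1) mod N)
      = c * v ?k * u j - b * v j * u ?k"
    by (simp add: algebra_simps)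
  also have "\<dots> = c * v (1 mod N) * u 0 - b * v 0 * u (1 mod N)" using Suc k by simp
  finally show ?case .
qed simp

theorem corollary1p4:
  fixes N :: nat and d p :: real and V :: "real vec"
  assumes "3 \<le> N" and "0 < d" and "V \<in> carrier_vec N"
  shows "(\<exists>a \<in> pos_sphere N. principal_eigenvalue N d p V
            = 2 * d * cyclic_cost N (real N * p) a - 2 * d + (\<Sum>j<N. V $ j * (a $ j)\<^sup>2))
       \<and> (\<forall>a \<in> pos_sphere N. 2 * d * cyclic_cost N (real N * p) a - 2 * d
            + (\<Sum>j<N. V $ j * (a $ j)\<^sup>2) \<le> principal_eigenvalue N d p V)"
proof -
  have N: "0 < N" using assms by simp
  note d = \<open>0 < d\<close>
  let ?b = "d * exp (- p)" and ?c = "d * exp p" and ?q = "\<lambda>j. V $ j - 2 * d"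
  have bc: "0 < ?b" "0 < ?c" using d by simp_all
  obtain r u where u: "\<And>j. j < N \<Longrightarrow> 0 < u j" "\<And>j. j < N \<Longrightarrow> cyc_op N ?b ?c ?q u j = r * u j"
    by (rule cyc_op_Perron[where q = ?q, OF N bc(1) less_imp_le[OF bc(2)]], rule that) blast+
  \<comment> \<open>Exchanging the two coefficients gives the transpose, so \<open>v\<close> is a
    left eigenvector of the original operator.\<close>
  obtain s v where v: "\<And>j. j < N \<Longrightarrow> 0 < v j"
    and vs: "\<And>j. j < N \<Longrightarrow> cyc_op N ?c ?b ?q v j = s * v j"
    by (rule cyc_op_Perron[where q = ?q, OF N bc(2) less_imp_le[OF bc(1)]], rule that) blast+
  have "r = s" by (rule cyc_op_eigen_adjoint_eq[OF N u v vs])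
  with vs have vr: "\<And>j. j < N \<Longrightarrow> cyc_op N ?c ?b ?q v j = r * v j" by simp
  have r: "principal_eigenvalue N d p V = r" by (rule principal_eigenvalue_eqI[OF N d u v vr])
  define \<theta> where "\<theta> a = tilt N p (\<lambda>j. a $ j / u j)" for a
  have \<theta>: "r = 2 * d * (\<Sum>j<N. a $ j * a $ ((j + 1) mod N) * cosh (\<theta> a j)) - 2 * d
      + (\<Sum>j<N. V $ j * (a $ j)\<^sup>2)"
    if "a \<in> pos_sphere N" for a
    unfolding \<theta>_def by (rule eigenvalue_tilt[OF u]) (use that in \<open>auto simp: pos_sphere_def\<close>)
  have le: "2 * d * cyclic_cost N (real N * p) a - 2 * d + (\<Sum>j<N. V $ j * (a $ j)\<^sup>2) \<le> r"
    if a: "a \<in> pos_sphere N" for a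
  proof -
    have "cyclic_cost N (real N * p) a \<le> (\<Sum>j<N. a $ j * a $ ((j + 1) mod N) * cosh (vec N (\<theta> a) $ j))"
      by (rule cyclic_cost_le[OF N a]) (simp_all add: \<theta>_def sum_tilt)
    then show ?thesis using d by (subst \<theta>[OF a]) simp
  qed
  define S where "S = (\<Sum>j<N. u j * v j)"
  have S: "0 < S" unfolding S_def using N u v by (intro sum_pos) auto
  define a where "a = vec N (\<lambda>j. sqrt (u j * v j / S))"
  have aj: "0 < a $ j" "(a $ j)\<^sup>2 = u j * v j / S" if "j < N" for j
    using u(1)[OF that] v[OF that] S that by (simp_all add: a_def)
  have a: "a \<in> pos_sphere N"
    using aj S by (auto simp: pos_sphere_def a_def S_def simp flip: sum_divide_distrib)
  \<comment> \<open>In the denominator, 2 comes from sinh, \<open>S\<close> from normalizing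
    \<open>a\<close>, and \<open>d\<close> compensates the factor contained in both
    coefficients.\<close>
  have flux: "a $ j * a $ ((j + 1) mod N) * sinh (\<theta> a j)
      = (?c * v (1 mod N) * u 0 - ?b * v 0 * u (1 mod N)) / (2 * d * S)" if j: "j < N" for j
  proof -
    let ?s = "(j + 1) mod N"
    have pos: "0 < u j" "0 < u ?s" "?s < N" using u j by auto
    have "2 * (a $ j * a $ ?s * sinh (\<theta> a j))
      = exp p * (a $ ?s)\<^sup>2 * u j / u ?s - exp (- p) * (a $ j)\<^sup>2 * u ?s / u j"
      unfolding \<theta>_def by (rule tilt_cosh_sinh(2)[OF j u(1) aj(1)])
    also have "\<dots> = (?c * v ?s * u j - ?b * v j * u ?s) / (d * S)"
      unfolding aj(2)[OF j] aj(2)[OF pos(3)] using pos d S by (simp add: field_simps)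
    also have "?c * v ?s * u j - ?b * v j * u ?s = ?c * v (1 mod N) * u 0 - ?b * v 0 * u (1 mod N)"
      by (rule cyc_op_flux_const[OF u(2) vr j])
    finally show ?thesis using d S by (simp add: field_simps)
  qed
  obtain t where t: "t \<in> carrier_vec N" "(\<Sum>j<N. t $ j) = real N * p"
    "cyclic_cost N (real N * p) a = (\<Sum>j<N. a $ j * a $ ((j + 1) mod N) * cosh (t $ j))"
    using cyclic_cost_attained[OF N a] .
  \<comment> \<open>The constant flux makes the angles \<open>\<theta> a\<close> no costlier than
    the minimizer \<open>t\<close>, which is the inequality missing for equality at
    \<open>a\<close>.\<close>
  have "(\<Sum>j<N. a $ j * a $ ((j + 1) mod N) * cosh (\<theta> a j)) \<le> cyclic_cost N (real N * p) a"
    unfolding t(3)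
  proof (rule weighted_cosh_sum_le[OF _ flux])
    show "0 \<le> a $ j * a $ ((j + 1) mod N)" if "j < N" for j
      using aj(1)[of j] aj(1)[of "(j + 1) mod N"] that by simp
  qed (simp_all add: t \<theta>_def sum_tilt)
  then have "r \<le> 2 * d * cyclic_cost N (real N * p) a - 2 * d + (\<Sum>j<N. V $ j * (a $ j)\<^sup>2)"
    using d by (subst \<theta>[OF a]) simp
  then show ?thesis unfolding r using le a by (meson antisym)
qed

end
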